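(* Let $f$ and $f'$ be maps on a finite set of $n$ elements, whose functional graphs have component sizes $t=(t_1,\ldots,t_s)$ with respective cycle sizes $c=(c_1,\ldots,c_s)$, and component sizes $t'=(t'_1,\ldots,t'_r)$ with respective cycle sizes $c'=(c'_1,\ldots,c'_r)$. Suppose $(t,c)\prec(t',c')$. Then $H_{f,\infty}<H_{f',\infty}$.
   Context: The functional graph of $g\colon X\to X$ has node set $X$ and directed edges $x\to g(x)$; each connected component (of the underlying undirected graph) contains exactly one cycle. If the components have sizes $t_1,\ldots,t_s$ and their cycles sizes $c_1,\ldots,c_s$, with $n=\#X$, the asymptotic iteration entropy is $H_{g,\infty}=\frac1n\sum_{1\le i\le s}t_i\log_2 c_i$. For sequences of positive integers $t=(t_1,\ldots,t_s)$, $c=(c_1,\ldots,c_s)$, $t'=(t'_1,\ldots,t'_r)$, $c'=(c'_1,\ldots,c'_r)$ with $r<s$, $n=\sum_i t_i=\sum_j t'_j$, $c_i\le t_i$ and $c'_j\le t'_j$ for all $i,j$, one writes $(t,c)\prec(t',c')$ if there exist pairwise disjoint sets $S_1,\ldots,S_r\subseteq\{1,\ldots,s\}$ such that $t'_j=\sum_{i\in S_j}t_i$ and $c'_j=\sum_{i\in S_j}c_i$ for $1\le j\le r$. *)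

theory Defs
  imports
    Complex_Main
    "HOL-Library.FuncSet"
    "HOL-Library.Disjoint_Sets"
    "Graph_Theory.Graph_Theory"
begin

definition functional_graph :: "'a set \<Rightarrow> ('a \<Rightarrow> 'a) \<Rightarrow> ('a, 'a \<times> 'a) pre_digraph" where
  "functional_graph X g = with_proj \<lparr> pverts = X, parcs = {(x, g x) | x. x \<in> X} \<rparr>"

text \<open>
  \<^const>\<open>Digraph_Component.connected\<close> refers to the underlying undirected graph, so these
  are the weakly connected components.
\<close>
definition components :: "('a, 'b) pre_digraph \<Rightarrow> ('a, 'b) pre_digraph set" where
  "components G = {C. pre_digraph.max_subgraph G Digraph_Component.connected C}"

text \<open>
  The library's cycles are closed directed walks given as arc lists; a loop is a cycle of length 1.
  A cycle of length \<open>k\<close> is counted by \<open>k\<close> such lists, one for each starting arc, so it is the length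
  that is uniquely determined when the graph has exactly one cycle.
\<close>
definition cycle_size :: "('a, 'b) pre_digraph \<Rightarrow> nat" where
  "cycle_size C = (THE k. \<exists>p. pre_digraph.cycle C p \<and> length p = k)"

definition iteration_entropy :: "'a set \<Rightarrow> ('a \<Rightarrow> 'a) \<Rightarrow> real" where
  "iteration_entropy X g =
     1 / real (card X) *
     (\<Sum>C\<in>components (functional_graph X g). real (card (verts C)) * log 2 (real (cycle_size C)))"

text \<open>
  \<open>t\<close> and \<open>c\<close> list the component sizes and the respective cycle sizes, for some enumeration
  without repetition of all components.
\<close>
definition has_component_sizes :: "'a set \<Rightarrow> ('a \<Rightarrow> 'a) \<Rightarrow> nat list \<Rightarrow> nat list \<Rightarrow> bool" where
  "has_component_sizes X g t c \<longleftrightarrow>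
     (\<exists>Cs. distinct Cs \<and> set Cs = components (functional_graph X g) \<and>
           t = map (\<lambda>C. card (verts C)) Cs \<and> c = map cycle_size Cs)"

text \<open>
  All conditions that delimit the domain of the relation are part of its definition. Positions in
  lists count from 0.
\<close>
definition prec :: "nat list \<times> nat list \<Rightarrow> nat list \<times> nat list \<Rightarrow> bool" (infix \<open>\<prec>\<close> 50) where
  "tc \<prec> tc' \<longleftrightarrow>
     (case (tc, tc') of ((t, c), (t', c')) \<Rightarrow>
        length c = length t \<and> length c' = length t' \<and> length t' < length t \<and>
        (\<forall>i<length t. 0 < t ! i \<and> 0 < c ! i \<and> c ! i \<le> t ! i) \<and>
        (\<forall>j<length t'. 0 < t' ! j \<and> 0 < c' ! j \<and> c' ! j \<le> t' ! j) \<and>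
        sum_list t = sum_list t' \<and>
        (\<exists>S :: nat \<Rightarrow> nat set.
           (\<forall>j<length t'. S j \<subseteq> {..<length t}) \<and>
           disjoint_family_on S {..<length t'} \<and>
           (\<forall>j<length t'. t' ! j = (\<Sum>i\<in>S j. t ! i) \<and> c' ! j = (\<Sum>i\<in>S j. c ! i))))"

lemma functional_graph_simps [simp]:
  "verts (functional_graph X g) = X"
  "arcs (functional_graph X g) = {(x, g x) | x. x \<in> X}"
  "tail (functional_graph X g) = fst" "head (functional_graph X g) = snd"
  by (auto simp: functional_graph_def)

text \<open>
  The following facts show that the components of a functional graph on a finite set are finitely
  many and that each contains exactly one cycle, so that \<^const>\<open>cycle_size\<close> is well defined.
\<close>
lemma component_structure:
  assumes g: "g \<in> X \<rightarrow> X" and C: "C \<in> components (functional_graph X g)"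
  shows "wf_digraph C" "Digraph_Component.connected C" "verts C \<subseteq> X" "g ` verts C \<subseteq> verts C"
    "arcs C = {(x, g x) | x. x \<in> verts C}" "tail C = fst" "head C = snd"
proof -
  let ?G = "functional_graph X g"
  have sub: "subgraph C ?G" and con: "Digraph_Component.connected C"
    and mx: "\<And>H. subgraph C H \<Longrightarrow> subgraph H ?G \<Longrightarrow> Digraph_Component.connected H \<Longrightarrow> H = C"
    using C by (auto simp: components_def pre_digraph.max_subgraph_def)
  have wfG: "wf_digraph ?G" using g by unfold_locales auto
  show wf: "wf_digraph C" and con: "Digraph_Component.connected C" and vX: "verts C \<subseteq> X"
    using sub con by (auto simp: subgraph_def)
  show tl: "tail C = fst" and hd: "head C = snd"
    using sub by (auto simp: subgraph_def compatible_def)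
  have aC: "arcs C \<subseteq> {(x, g x) | x. x \<in> X}" using sub by (auto simp: subgraph_def)
  have "(v, g v) \<in> arcs C" if v: "v \<in> verts C" for v
  proof -
    define H where "H = \<lparr>verts = insert (g v) (verts C), arcs = insert (v, g v) (arcs C), tail = fst, head = (snd :: 'a \<times> 'a \<Rightarrow> 'a)\<rparr>"
    have wfH: "wf_digraph H"
      using wf_digraph.tail_in_verts[OF wf] wf_digraph.head_in_verts[OF wf] v
      by unfold_locales (auto simp: H_def tl hd)
    have "subgraph C H" using wf wfH by (auto simp: subgraph_def H_def compatible_def tl hd)
    moreover have "subgraph H ?G"
      using wfH wfG sub v vX g by (auto simp: subgraph_def H_def compatible_def)
    moreover have "Digraph_Component.connected H"
    proof -
      let ?R = "rtrancl_on (verts H) ((arcs_ends H)\<^sup>s)"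
      have "verts C \<subseteq> verts H" "(arcs_ends C)\<^sup>s \<subseteq> (arcs_ends H)\<^sup>s"
        by (auto simp: H_def arcs_ends_conv symcl_def tl hd)
      then have 1: "(a, b) \<in> ?R" if "a \<in> verts C" "b \<in> verts C" for a b
        using con that unfolding connected_conv by (meson rtrancl_on_mono subsetD)
      have e: "(v, g v) \<in> ?R" "(g v, v) \<in> ?R" "(g v, g v) \<in> ?R"
      proof -
        have "v \<in> verts H" "g v \<in> verts H" "(v, g v) \<in> (arcs_ends H)\<^sup>s" "(g v, v) \<in> (arcs_ends H)\<^sup>s"
          using v by (auto simp: H_def arcs_ends_conv symcl_def)
        then show "(v, g v) \<in> ?R" "(g v, v) \<in> ?R" "(g v, g v) \<in> ?R"
          by (meson rtrancl_on.intros)+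
      qed
      have "(a, b) \<in> ?R" if "a \<in> verts H" "b \<in> verts H" for a b
      proof (rule rtrancl_on_trans)
        show "(a, v) \<in> ?R" "(v, b) \<in> ?R" using that e 1 v by (auto simp: H_def)
      qed
      then show ?thesis unfolding connected_conv by (auto simp: H_def)
    qed
    ultimately have "H = C" by (rule mx)
    moreover have "(v, g v) \<in> arcs H" by (simp add: H_def)
    ultimately show ?thesis by simp
  qed
  then show arcs: "arcs C = {(x, g x) | x. x \<in> verts C}"
    using aC wf_digraph.tail_in_verts[OF wf] by (fastforce simp: tl)
  show "g ` verts C \<subseteq> verts C" using wf_digraph.head_in_verts[OF wf] by (auto simp: arcs hd)
qed


lemma cycle_arcs:
  assumes g: "g \<in> X \<rightarrow> X" and C: "C \<in> components (functional_graph X g)"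
    and p: "pre_digraph.cycle C p"
  obtains u where "u \<in> verts C" "(g ^^ length p) u = u" "0 < length p" "distinct p"
    "set p = range (\<lambda>i. ((g ^^ i) u, (g ^^ Suc i) u))"
proof -
  note cs = component_structure[OF g C]
  interpret wf_digraph C by (rule cs(1))
  have cas_p: "w = (g ^^ length q) u \<and> q = map (\<lambda>i. ((g ^^ i) u, (g ^^ Suc i) u)) [0..<length q]"
    if "cas u q w" "set q \<subseteq> arcs C" for u q w
    using that
  proof (induction q arbitrary: u)
    case (Cons e q)
    then have e: "e = (u, g u)" and q: "cas (g u) q w" "set q \<subseteq> arcs C"
      by (auto simp: cs)
    have "w = (g ^^ length q) (g u)"
      and "q = map (\<lambda>i. ((g ^^ i) (g u), (g ^^ Suc i) (g u))) [0..<length q]"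
      using Cons.IH[OF q] by auto
    then show ?case
      unfolding e by (auto simp: funpow_swap1 upt_conv_Cons map_Suc_upt[symmetric] o_def simp del: upt_Suc)
  qed auto
  obtain u where u: "awalk u p u" "distinct p" "p \<noteq> []"
    using p unfolding cycle_conv by blast
  let ?k = "length p"
  let ?a = "\<lambda>i. ((g ^^ i) u, (g ^^ Suc i) u)"
  have uk: "(g ^^ ?k) u = u" and pm: "p = map ?a [0..<?k]"
    using cas_p[of u p u] u by (auto simp: awalk_def)
  have "set p = ?a ` {..<?k}" by (subst pm) (simp add: atLeast0LessThan)
  moreover have "?a i \<in> ?a ` {..<?k}" for i
  proof
    show "?a i = ?a (i mod ?k)" using funpow_mod_eq[OF uk] by (simp add: funpow_swap1)
    show "i mod ?k \<in> {..<?k}" using u by simp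
  qed
  ultimately have "set p = range ?a" by blast
  with u uk that show thesis by (auto simp: awalk_def)
qed

lemma cycle_unique:
  assumes g: "g \<in> X \<rightarrow> X" and C: "C \<in> components (functional_graph X g)"
    and p: "pre_digraph.cycle C p" and q: "pre_digraph.cycle C q"
  shows "set p = set q" "length p = length q"
proof -
  note cs = component_structure[OF g C]
  obtain u where u: "u \<in> verts C" "(g ^^ length p) u = u" "0 < length p" "distinct p"
    "set p = range (\<lambda>i. ((g ^^ i) u, (g ^^ Suc i) u))"
    by (rule cycle_arcs[OF g C p])
  obtain w where w: "w \<in> verts C" "(g ^^ length q) w = w" "0 < length q" "distinct q"
    "set q = range (\<lambda>i. ((g ^^ i) w, (g ^^ Suc i) w))"
    by (rule cycle_arcs[OF g C q])
  have "(u, w) \<in> rtrancl_on (verts C) ((arcs_ends C)\<^sup>s)"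
    using cs(2) u(1) w(1) unfolding connected_conv by blast
  then have "\<exists>i j. (g ^^ i) u = (g ^^ j) w"
  proof (induction rule: rtrancl_on_induct)
    case base
    then show ?case by blast
  next
    case (step y z)
    then obtain i j where ij: "(g ^^ i) u = (g ^^ j) y" by blast
    have "z = g y \<or> y = g z" using step by (auto simp: arcs_ends_conv symcl_def cs)
    then show ?case
    proof
      assume "z = g y"
      then have "(g ^^ Suc i) u = (g ^^ j) z" using ij by (simp add: funpow_swap1)
      then show ?case by blast
    next
      assume "y = g z"
      then have "(g ^^ i) u = (g ^^ Suc j) z" using ij by (simp add: funpow_swap1)
      then show ?case by blast
    qed
  qed
  then obtain i j where ij: "(g ^^ i) u = (g ^^ j) w" by blast
  have return: "\<exists>m. x = (g ^^ m) y"
    if "(g ^^ k) x = x" "0 < k" "(g ^^ i) x = (g ^^ j) y" for k x y i j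
  proof -
    have "(g ^^ (i * k)) x = x" using that(1) by (metis funpow_0 funpow_mod_eq mod_mult_self2_is_0)
    moreover have "i * k = (i * k - i) + i" using that(2) by simp
    ultimately have "x = (g ^^ (i * k - i)) ((g ^^ i) x)"
      by (metis comp_apply funpow_add)
    also have "\<dots> = (g ^^ (i * k - i + j)) y" by (simp add: that(3) funpow_add)
    finally show ?thesis ..
  qed
  obtain m where m: "u = (g ^^ m) w" using return[OF u(2,3) ij] ..
  obtain m' where m': "w = (g ^^ m') u" using return[OF w(2,3) ij[symmetric]] ..
  have "set p \<subseteq> set q"
    unfolding u(5) w(5)
  proof clarify
    fix a
    have "(g ^^ a) u = (g ^^ (a + m)) w" by (simp add: m funpow_add)
    then show "((g ^^ a) u, (g ^^ Suc a) u) \<in> range (\<lambda>i. ((g ^^ i) w, (g ^^ Suc i) w))"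
      by (intro range_eqI[of _ _ "a + m"]) simp
  qed
  moreover have "set q \<subseteq> set p"
    unfolding u(5) w(5)
  proof clarify
    fix a
    have "(g ^^ a) w = (g ^^ (a + m')) u" by (simp add: m' funpow_add)
    then show "((g ^^ a) w, (g ^^ Suc a) w) \<in> range (\<lambda>i. ((g ^^ i) u, (g ^^ Suc i) u))"
      by (intro range_eqI[of _ _ "a + m'"]) simp
  qed
  ultimately show "set p = set q" by blast
  then show "length p = length q" using u(4) w(4) by (metis distinct_card)
qed

lemma cycle_exists:
  assumes fin: "finite X" and g: "g \<in> X \<rightarrow> X" and C: "C \<in> components (functional_graph X g)"
  shows "\<exists>p. pre_digraph.cycle C p"
proof -
  note cs = component_structure[OF g C]
  interpret wf_digraph C by (rule cs(1))
  obtain v where v: "v \<in> verts C" using cs(2) by (auto simp: connected_conv)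
  have it: "(g ^^ i) v \<in> verts C" for i using v cs(4) by (induction i) auto
  have "finite (range (\<lambda>i. (g ^^ i) v))"
    using it cs(3) fin by (meson finite_subset image_subsetI)
  then have "\<not> inj (\<lambda>i. (g ^^ i) v)" by (metis finite_imageD infinite_UNIV_nat)
  then obtain i j where "i \<noteq> j" "(g ^^ i) v = (g ^^ j) v" by (auto simp: inj_def)
  then obtain i j where ij: "i < j" "(g ^^ i) v = (g ^^ j) v" by (metis nat_neq_iff)
  define u where "u = (g ^^ i) v"
  have u: "u \<in> verts C" by (simp add: u_def it)
  have "(g ^^ (j - i)) u = u"
  proof -
    have "(g ^^ (j - i)) u = (g ^^ (j - i + i)) v" by (simp only: u_def funpow_add comp_apply)
    then show ?thesis using ij by (simp add: u_def)
  qed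
  moreover have "\<exists>q. awalk u q ((g ^^ k) u) \<and> length q = k" for k
  proof (induction k)
    case 0
    then show ?case using u by (auto simp: awalk_def)
  next
    case (Suc k)
    then obtain q where q: "awalk u q ((g ^^ k) u)" "length q = k" by blast
    have "arc_to_ends C ((g ^^ k) u, g ((g ^^ k) u)) = ((g ^^ k) u, g ((g ^^ k) u))"
      by (simp add: arc_to_ends_def cs)
    moreover have "(g ^^ k) u \<in> verts C" using q(1) by (auto dest: awalk_last_in_verts)
    ultimately have "awalk ((g ^^ k) u) [((g ^^ k) u, g ((g ^^ k) u))] (g ((g ^^ k) u))"
      using cs(4) by (auto simp: awalk_def cs)
    from awalk_appendI[OF q(1) this]
    have "awalk u (q @ [((g ^^ k) u, g ((g ^^ k) u))]) ((g ^^ Suc k) u)" by simp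
    with q(2) show ?case by (metis length_append_singleton)
  qed
  ultimately obtain q where "awalk u q u" "length q = j - i" by metis
  then have "closed_w q" using ij by (auto simp: closed_w_def)
  then show ?thesis by (rule closed_w_imp_cycle)
qed

lemma cycle_size_eq:
  assumes "g \<in> X \<rightarrow> X" "C \<in> components (functional_graph X g)" "pre_digraph.cycle C p"
  shows "cycle_size C = length p"
  unfolding cycle_size_def using assms cycle_unique(2) by (intro the_equality) blast+


lemma finite_components:
  assumes "finite X" and g: "g \<in> X \<rightarrow> X"
  shows "finite (components (functional_graph X g))"
proof (rule inj_on_finite)
  show "inj_on verts (components (functional_graph X g))"
  proof (rule inj_onI)
    fix C D assume "C \<in> components (functional_graph X g)" "D \<in> components (functional_graph X g)"
      and "verts C = verts D"
    then show "C = D" using component_structure(5-7)[OF g] by (intro pre_digraph.equality) auto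
  qed
  show "verts ` components (functional_graph X g) \<subseteq> Pow X" using component_structure(3)[OF g] by blast
  show "finite (Pow X)" using assms by simp
qed

end

theory Submission
  imports Defs
begin

text \<open>
  Since all component sizes are positive and \<open>t\<close>, \<open>t'\<close> have the same sum, the sets \<open>S j\<close> cover all
  positions of \<open>t\<close>. Replacing each \<open>log 2 (c ! i)\<close> with \<open>i \<in> S j\<close> by the larger \<open>log 2 (c' ! j)\<close>
  turns the first entropy sum into the second. As there are fewer sets than positions, some \<open>S j\<close>
  has two elements, and there the replacement is a strict increase.
\<close>

lemma prec_sum_log_less:
  assumes "(t, c) \<prec> (t', c')"
  shows "(\<Sum>i<length t. real (t ! i) * log 2 (real (c ! i))) <
    (\<Sum>j<length t'. real (t' ! j) * log 2 (real (c' ! j)))"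
proof -
  from assms obtain S :: "nat \<Rightarrow> nat set" where less: "length t' < length t"
    and pos: "\<And>i. i < length t \<Longrightarrow> 0 < t ! i \<and> 0 < c ! i"
    and total: "sum_list t = sum_list t'"
    and sub: "\<And>j. j < length t' \<Longrightarrow> S j \<subseteq> {..<length t}"
    and disj: "disjoint_family_on S {..<length t'}"
    and tS: "\<And>j. j < length t' \<Longrightarrow> t' ! j = (\<Sum>i\<in>S j. t ! i)"
    and cS: "\<And>j. j < length t' \<Longrightarrow> c' ! j = (\<Sum>i\<in>S j. c ! i)"
    unfolding prec_def case_prod_conv by metis
  define U where "U = (\<Union>j<length t'. S j)"
  have fin: "finite (S j)" if "j < length t'" for j
    using sub[OF that] finite_subset by blast
  have U_sub: "U \<subseteq> {..<length t}" using sub by (auto simp: U_def)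
  \<comment> \<open>Disjointness splits a sum over \<open>U\<close> into blocks. \<open>h\<close>
    stays general since it is needed for the sizes, for the constant 1 that counts positions, and
    for the real logarithmic terms.\<close>
  have sum_U: "sum h U = (\<Sum>j<length t'. sum h (S j))" for h :: "nat \<Rightarrow> 'b::comm_monoid_add"
    unfolding U_def using fin disj
    by (intro sum.UNION_disjoint) (auto simp: disjoint_family_on_def)
  have "(\<Sum>i\<in>U. t ! i) = (\<Sum>i<length t. t ! i)"
    using total tS by (simp add: sum_U sum_list_sum_nth atLeast0LessThan)
  moreover have "(\<Sum>i<length t. t ! i) = (\<Sum>i\<in>U. t ! i) + (\<Sum>i\<in>{..<length t} - U. t ! i)"
    using U_sub by (simp add: sum.subset_diff add.commute)
  \<comment> \<open>Cancelling the common sum leaves total size 0 outside \<open>U\<close>, which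
    positive sizes allow only if nothing lies there.\<close>
  ultimately have "(\<Sum>i\<in>{..<length t} - U. t ! i) = 0" by simp
  then have "\<forall>i\<in>{..<length t} - U. t ! i = 0" by simp
  then have U: "U = {..<length t}" using U_sub pos
    by (metis Diff_iff less_irrefl lessThan_iff subsetI subset_antisym)
  have c_le: "c ! i \<le> c' ! j" if "j < length t'" "i \<in> S j" for i j
    using that fin cS by (simp add: member_le_sum)
  have pos_S: "0 < t ! i" "0 < c ! i" if "j < length t'" "i \<in> S j" for i j
    using that sub pos by blast+
  have t'_log: "real (t' ! j) * log 2 (real (c' ! j)) =
      (\<Sum>i\<in>S j. real (t ! i) * log 2 (real (c' ! j)))" if "j < length t'" for j
    using tS[OF that] by (simp add: sum_distrib_right)
  \<comment> \<open>Pigeonhole: with at most one element in each \<open>S j\<close>,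
    \<open>U\<close> would have at most \<open>length t'\<close> elements, but it has
    \<open>length t\<close>.\<close>
  have "\<exists>j<length t'. 1 < card (S j)"
  proof (rule ccontr)
    assume "\<not> ?thesis"
    then have "(\<Sum>j<length t'. card (S j)) \<le> (\<Sum>j<length t'. 1)"
      by (intro sum_mono) (meson lessThan_iff not_less)
    moreover have "card U = (\<Sum>j<length t'. card (S j))"
      using sum_U[of "\<lambda>_. 1 :: nat"] by simp
    ultimately show False using less U by simp
  qed
  then obtain m where m: "m < length t'" "1 < card (S m)" by blast
  have c_less: "c ! i < c' ! m" if i: "i \<in> S m" for i
  proof -
    \<comment> \<open>A second position in \<open>S m\<close> contributes a positive cycle size to
      \<open>c' ! m\<close> on top of \<open>c ! i\<close>.\<close>
    have "S m - {i} \<noteq> {}" using m i by (auto dest: card_mono[rotated])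
    then have "0 < (\<Sum>k\<in>S m - {i}. c ! k)"
      using fin m pos_S by (intro sum_pos) auto
    then show ?thesis using cS[OF m(1)] sum.remove[OF fin[OF m(1)] i, of "(!) c"] by simp
  qed
  have "(\<Sum>i<length t. real (t ! i) * log 2 (real (c ! i))) =
      (\<Sum>j<length t'. \<Sum>i\<in>S j. real (t ! i) * log 2 (real (c ! i)))"
    using sum_U U by metis
  also have "\<dots> < (\<Sum>j<length t'. \<Sum>i\<in>S j. real (t ! i) * log 2 (real (c' ! j)))"
  proof (rule sum_strict_mono_ex1)
    have "real (t ! i) * log 2 (real (c ! i)) \<le> real (t ! i) * log 2 (real (c' ! j))"
      if "j < length t'" "i \<in> S j" for i j
      using c_le[OF that] pos_S[OF that] by (intro mult_left_mono) auto
    then show "\<forall>j\<in>{..<length t'}. (\<Sum>i\<in>S j. real (t ! i) * log 2 (real (c ! i))) \<le>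
        (\<Sum>i\<in>S j. real (t ! i) * log 2 (real (c' ! j)))"
      by (auto intro!: sum_mono)
    have "real (t ! i) * log 2 (real (c ! i)) < real (t ! i) * log 2 (real (c' ! m))"
      if "i \<in> S m" for i
      using c_less[OF that] pos_S[OF m(1) that] by (intro mult_strict_left_mono) auto
    \<comment> \<open>Termwise strictness passes to the sum only over a nonempty index set.\<close>
    moreover have "S m \<noteq> {}" using m by auto
    ultimately show "\<exists>j\<in>{..<length t'}. (\<Sum>i\<in>S j. real (t ! i) * log 2 (real (c ! i))) <
        (\<Sum>i\<in>S j. real (t ! i) * log 2 (real (c' ! j)))"
      using m fin by (intro bexI[of _ m] sum_strict_mono) auto
  qed simp
  also have "\<dots> = (\<Sum>j<length t'. real (t' ! j) * log 2 (real (c' ! j)))"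
    using t'_log by simp
  finally show ?thesis .
qed

text \<open>The enumeration of the components has no repetition, so indexing into it is a bijection
  from positions to components, along which the sum is reindexed.\<close>

lemma iteration_entropy_eq:
  assumes "has_component_sizes X g t c"
  shows "iteration_entropy X g =
    1 / real (card X) * (\<Sum>i<length t. real (t ! i) * log 2 (real (c ! i)))"
proof -
  obtain Cs where Cs: "distinct Cs" "set Cs = components (functional_graph X g)"
    "t = map (\<lambda>C. card (verts C)) Cs" "c = map cycle_size Cs"
    using assms unfolding has_component_sizes_def by blast
  have "bij_betw ((!) Cs) {..<length Cs} (components (functional_graph X g))"
    using Cs by (intro bij_betw_nth) auto
  from sum.reindex_bij_betw[OF this, of "\<lambda>C. real (card (verts C)) * log 2 (real (cycle_size C))"]
  show ?thesis
    by (simp add: iteration_entropy_def Cs(3,4))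
qed

theorem theorem3:
  fixes X :: "'a set" and f f' :: "'a \<Rightarrow> 'a" and t c t' c' :: "nat list"
  assumes "finite X"
    and "f \<in> X \<rightarrow> X" and "f' \<in> X \<rightarrow> X"
    and "has_component_sizes X f t c" and "has_component_sizes X f' t' c'"
    and "(t, c) \<prec> (t', c')"
  shows "iteration_entropy X f < iteration_entropy X f'"
proof -
  \<comment> \<open>The factor \<open>1 / real (card X)\<close> must be positive to preserve the
    strict inequality; for empty \<open>X\<close> it would be 0. A component exists because
    \<open>length t' < length t\<close>, and connectedness makes its vertex set nonempty.\<close>
  have "0 < length t" using assms(6) by (auto simp: prec_def)
  then obtain C where C: "C \<in> components (functional_graph X f)"
    using assms(4) unfolding has_component_sizes_def by fastforce
  have "verts C \<noteq> {}"
    using component_structure(2)[OF assms(2) C] by (auto simp: connected_conv)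
  then have "0 < card X"
    using component_structure(3)[OF assms(2) C] assms(1) by (auto simp: card_gt_0_iff)
  then show ?thesis
    using prec_sum_log_less[OF assms(6)]
    unfolding iteration_entropy_eq[OF assms(4)] iteration_entropy_eq[OF assms(5)]
    by (intro mult_strict_left_mono) auto
qed

end
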